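(* There exists a class of NFAs such that, for each NFA $\mathcal{A}=(Q,\delta,\Sigma,s)$ in this class: the quotient automaton $\mathcal{A}/_{\sim_{R}}$, defined by the maximum co-lex relation $\leq_R$ of $\mathcal{A}$, has a number of states and a co-lexicographic width equal to $O(\lvert Q\rvert)$, while the quotient automaton $\mathcal{A}/_{\sim_{FS}}$, defined by the coarsest forward-stable co-lex (CFS) order $\leq_{FS}$ of $\mathcal{A}$, has a number of states and a co-lexicographic width equal to $O(1)$.
   Context: NFA: a tuple $(Q,\delta,\Sigma,s)$ with finite state set $Q$, finite alphabet $\Sigma$, transition function $\delta:Q\times\Sigma\to 2^Q$ and initial state $s\in Q$ (no set of final states). Standing assumptions: every state is reachable from $s$; $s$ has no incoming edges; every character of $\Sigma$ labels at least one transition. Write $\delta_a(u)=\delta(u,a)$ and $\delta_a(S)=\bigcup_{u\in S}\delta_a(u)$ for $S\subseteq Q$. The set $\Sigma\cup\{\#\}$ ($\#\notin\Sigma$) carries a fixed total order with $\#<a$ for all $a\in\Sigma$. For $u\ne s$, $\lambda(u)\subseteq\Sigma$ is the set of labels of edges entering $u$; $\lambda(s)=\{\#\}$. $\lambda(u)\le\lambda(v)$ means $a\le a'$ for all $a\in\lambda(u)$, $a'\in\lambda(v)$. Forward-stability: for $S,T\subseteq Q$, $S$ is forward-stable w.r.t. $T$ if for every $a\in\Sigma$ either $S\subseteq\delta_a(T)$ or $S\cap\delta_a(T)=\emptyset$. A partition of $Q$ is forward-stable for $\mathcal{A}$ if each part is forward-stable w.r.t. each part. The coarsest forward-stable partition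 is the unique forward-stable partition of which every forward-stable partition is a refinement (it always exists). A partial preorder is a reflexive transitive relation; it induces the equivalence $u\sim v\iff u\le v$ and $v\le u$. For a partial order or preorder, $u<v$ means $u\le v$ and not $v\le u$; an antichain is a set in which no two distinct elements $u,v$ satisfy $u\le v$ or $v\le u$; the width is the size of a largest antichain. Quotient automaton: for an equivalence relation $\sim$ on $Q$, $\mathcal{A}/_\sim=(Q/_\sim,\delta/_\sim,\Sigma,[s]_\sim)$, where $[v]_\sim\in\delta/_\sim([u]_\sim,a)$ iff there are $u'\in[u]_\sim$, $v'\in[v]_\sim$ with $v'\in\delta(u',a)$. Co-lex order of $\mathcal{A}$: a partial order $\le$ on $Q$ such that (1) $u<v$ implies $\lambda(u)\le\lambda(v)$; (2) whenever $u\in\delta_a(u')$, $v\in\delta_a(v')$ and $u<v$, then $u'\le v'$. The maximum co-lex order, if it exists, is a co-lex order equal to the union of all co-lex orders. The co-lexicographic width of $\mathcal{A}$ is the smallest width of a co-lex order of $\mathcal{A}$. Co-lex relation of $\mathcal{A}$: a reflexive relation $R$ on $Q$ such that (1) for $u\ne v$, $(u,v)\in R$ implies $\lambda(u)\le\lambda(v)$; (2) for $u\in\delta_a(u')$, $v\in\delta_a(v')$ with $u\neq v$, $(u,v)\in R$ implies $(u',v')\in R$. The maximum co-lex relation $\le_R$ is the union of all co-lex relations; it is itself a co-lex relation and a partial preorder; $\sim_R$ is its induced equivalence. CFS order: let $\sim_{FS}$ be the equivalence on $Q$ whose classes are the parts of the coarsest forward-stable partition for $\mathcal{A}$. The quotient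 $\mathcal{A}/_{\sim_{FS}}$ always admits a maximum co-lex order $\le$, and the CFS order $\le_{FS}$ is defined by $u\le_{FS}v\iff[u]_{\sim_{FS}}\le[v]_{\sim_{FS}}$. It is a partial preorder whose induced equivalence is $\sim_{FS}$. *)

theory Defs
  imports Complex_Main "HOL-Library.Disjoint_Sets" "HOL-Library.Option_ord"
    "HOL-Library.Landau_Symbols"
begin

record ('q, 'a) nfa =
  states :: "'q set"
  alphabet :: "'a set"
  delta :: "'q \<Rightarrow> 'a \<Rightarrow> 'q set"
  start :: 'q

definition delta_set :: "('q, 'a) nfa \<Rightarrow> 'a \<Rightarrow> 'q set \<Rightarrow> 'q set" where
  "delta_set A a S = (\<Union>u\<in>S. delta A u a)"

definition edges :: "('q, 'a) nfa \<Rightarrow> ('q \<times> 'q) set" where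
  "edges A = {(u, v). u \<in> states A \<and> (\<exists>a\<in>alphabet A. v \<in> delta A u a)}"

text \<open>The values of \<open>delta\<close> outside \<open>states \<times> alphabet\<close> are irrelevant and never inspected.\<close>

definition is_nfa :: "('q, 'a) nfa \<Rightarrow> bool" where
  "is_nfa A \<longleftrightarrow>
     finite (states A) \<and> finite (alphabet A) \<and> start A \<in> states A \<and>
     (\<forall>u\<in>states A. \<forall>a\<in>alphabet A. delta A u a \<subseteq> states A) \<and>
     (\<forall>u\<in>states A. (start A, u) \<in> (edges A)\<^sup>*) \<and>
     (\<forall>u\<in>states A. \<forall>a\<in>alphabet A. start A \<notin> delta A u a) \<and>
     (\<forall>a\<in>alphabet A. \<exists>u\<in>states A. delta A u a \<noteq> {})"

text \<open>The extra character \<open>#\<close> is \<open>None\<close>: in the order of \<open>Option_ord\<close> it lies strictly below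
  every \<open>Some a\<close>, and \<open>Some\<close> preserves the order of the characters.\<close>

definition in_labels :: "('q, 'a) nfa \<Rightarrow> 'q \<Rightarrow> 'a option set" where
  "in_labels A u =
     (if u = start A then {None}
      else Some ` {a \<in> alphabet A. \<exists>u'\<in>states A. u \<in> delta A u' a})"

definition labels_le :: "'a::linorder option set \<Rightarrow> 'a option set \<Rightarrow> bool" where
  "labels_le L L' \<longleftrightarrow> (\<forall>a\<in>L. \<forall>a'\<in>L'. a \<le> a')"

definition quotient_nfa :: "('q, 'a) nfa \<Rightarrow> ('q \<times> 'q) set \<Rightarrow> ('q set, 'a) nfa" where
  "quotient_nfa A r =
     \<lparr>states = states A // r,
      alphabet = alphabet A,
      delta = (\<lambda>U a. {V \<in> states A // r. \<exists>u'\<in>U. \<exists>v'\<in>V. v' \<in> delta A u' a}),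
      start = r `` {start A}\<rparr>"

definition induced_equiv :: "('q \<times> 'q) set \<Rightarrow> ('q \<times> 'q) set" where
  "induced_equiv r = {(u, v). (u, v) \<in> r \<and> (v, u) \<in> r}"

definition antichain_in :: "'q set \<Rightarrow> ('q \<times> 'q) set \<Rightarrow> 'q set \<Rightarrow> bool" where
  "antichain_in Q r X \<longleftrightarrow>
     X \<subseteq> Q \<and> (\<forall>u\<in>X. \<forall>v\<in>X. u \<noteq> v \<longrightarrow> (u, v) \<notin> r \<and> (v, u) \<notin> r)"

definition width :: "'q set \<Rightarrow> ('q \<times> 'q) set \<Rightarrow> nat" where
  "width Q r = Max (card ` {X. antichain_in Q r X})"

definition colex_order :: "('q, 'a::linorder) nfa \<Rightarrow> ('q \<times> 'q) set \<Rightarrow> bool" where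
  "colex_order A r \<longleftrightarrow>
     partial_order_on (states A) r \<and>
     (\<forall>u v. (u, v) \<in> r \<and> (v, u) \<notin> r \<longrightarrow> labels_le (in_labels A u) (in_labels A v)) \<and>
     (\<forall>a\<in>alphabet A. \<forall>u'\<in>states A. \<forall>v'\<in>states A. \<forall>u\<in>delta A u' a. \<forall>v\<in>delta A v' a.
        (u, v) \<in> r \<and> (v, u) \<notin> r \<longrightarrow> (u', v') \<in> r)"

definition is_max_colex_order :: "('q, 'a::linorder) nfa \<Rightarrow> ('q \<times> 'q) set \<Rightarrow> bool" where
  "is_max_colex_order A r \<longleftrightarrow> colex_order A r \<and> r = \<Union>{r'. colex_order A r'}"

definition max_colex_order :: "('q, 'a::linorder) nfa \<Rightarrow> ('q \<times> 'q) set" where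
  "max_colex_order A = (THE r. is_max_colex_order A r)"

definition colex_width :: "('q, 'a::linorder) nfa \<Rightarrow> nat" where
  "colex_width A = (LEAST k. \<exists>r. colex_order A r \<and> width (states A) r = k)"

definition colex_rel :: "('q, 'a::linorder) nfa \<Rightarrow> ('q \<times> 'q) set \<Rightarrow> bool" where
  "colex_rel A r \<longleftrightarrow>
     r \<subseteq> states A \<times> states A \<and> refl_on (states A) r \<and>
     (\<forall>u v. u \<noteq> v \<and> (u, v) \<in> r \<longrightarrow> labels_le (in_labels A u) (in_labels A v)) \<and>
     (\<forall>a\<in>alphabet A. \<forall>u'\<in>states A. \<forall>v'\<in>states A. \<forall>u\<in>delta A u' a. \<forall>v\<in>delta A v' a.
        u \<noteq> v \<and> (u, v) \<in> r \<longrightarrow> (u', v') \<in> r)"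

definition max_colex_rel :: "('q, 'a::linorder) nfa \<Rightarrow> ('q \<times> 'q) set" where
  "max_colex_rel A = \<Union>{r. colex_rel A r}"

definition forward_stable_wrt :: "('q, 'a) nfa \<Rightarrow> 'q set \<Rightarrow> 'q set \<Rightarrow> bool" where
  "forward_stable_wrt A S T \<longleftrightarrow>
     (\<forall>a\<in>alphabet A. S \<subseteq> delta_set A a T \<or> S \<inter> delta_set A a T = {})"

definition forward_stable :: "('q, 'a) nfa \<Rightarrow> 'q set set \<Rightarrow> bool" where
  "forward_stable A P \<longleftrightarrow>
     partition_on (states A) P \<and> (\<forall>S\<in>P. \<forall>T\<in>P. forward_stable_wrt A S T)"

definition is_coarsest_fs :: "('q, 'a) nfa \<Rightarrow> 'q set set \<Rightarrow> bool" where
  "is_coarsest_fs A P \<longleftrightarrow>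
     forward_stable A P \<and> (\<forall>P'. forward_stable A P' \<longrightarrow> refines (states A) P' P)"

definition coarsest_fs :: "('q, 'a) nfa \<Rightarrow> 'q set set" where
  "coarsest_fs A = (THE P. is_coarsest_fs A P)"

definition fs_equiv :: "('q, 'a) nfa \<Rightarrow> ('q \<times> 'q) set" where
  "fs_equiv A = {(u, v). \<exists>S\<in>coarsest_fs A. u \<in> S \<and> v \<in> S}"

definition cfs_order :: "('q, 'a::linorder) nfa \<Rightarrow> ('q \<times> 'q) set" where
  "cfs_order A =
     {(u, v). u \<in> states A \<and> v \<in> states A \<and>
        (fs_equiv A `` {u}, fs_equiv A `` {v}) \<in> max_colex_order (quotient_nfa A (fs_equiv A))}"

definition colex_rel_quotient :: "('q, 'a::linorder) nfa \<Rightarrow> ('q set, 'a) nfa" where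
  "colex_rel_quotient A = quotient_nfa A (induced_equiv (max_colex_rel A))"

text \<open>The equivalence induced by the CFS order is \<open>fs_equiv\<close>, because the order used on the
  quotient is antisymmetric.\<close>

definition cfs_quotient :: "('q, 'a::linorder) nfa \<Rightarrow> ('q set, 'a) nfa" where
  "cfs_quotient A = quotient_nfa A (induced_equiv (cfs_order A))"

end

theory Submission
  imports Defs
begin

text \<open>The start state \<open>0\<close> has an edge to each of the states \<open>1, \<dots>, n\<close> for each of two characters.
  As \<open>{0, 1}\<close> is not \<open>\<le>\<close> itself as a label set, the states \<open>1, \<dots>, n\<close> are pairwise incomparable in
  every co-lex relation, and their singletons stay incomparable in every co-lex order of the
  quotient. Forward-stability does not separate them, so the CFS quotient has only two states.\<close>

section \<open>The co-lexicographic width\<close>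

text \<open>Guarantees that some co-lex order exists, so that the minimum in
  \<open>colex_width\<close> is attained.\<close>

lemma colex_order_Id_on: "colex_order A (Id_on (states A))"
  by (auto simp: colex_order_def partial_order_on_def preorder_on_def refl_on_def
      intro: transI antisymI)

lemma finite_antichains: "finite Q \<Longrightarrow> finite {X. antichain_in Q r X}"
  by (rule finite_subset[of _ "Pow Q"]) (auto simp: antichain_in_def)

lemma card_antichain_le_width:
  assumes "finite Q" "antichain_in Q r X"
  shows "card X \<le> width Q r"
  unfolding width_def using assms by (intro Max_ge finite_imageI finite_antichains imageI CollectI)

lemma width_le_card:
  assumes "finite Q"
  shows "width Q r \<le> card Q"
proof -
  have "{} \<in> {X. antichain_in Q r X}"
    by (simp add: antichain_in_def)
  then have "Max (card ` {X. antichain_in Q r X}) \<in> card ` {X. antichain_in Q r X}"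
    by (intro Max_in finite_imageI finite_antichains assms) blast
  then obtain X where "antichain_in Q r X" "width Q r = card X"
    unfolding width_def by blast
  then show ?thesis
    using assms by (simp add: antichain_in_def card_mono)
qed

lemma colex_width_le_card:
  assumes "finite (states A)"
  shows "colex_width A \<le> card (states A)"
proof -
  have "colex_width A \<le> width (states A) (Id_on (states A))"
    unfolding colex_width_def using colex_order_Id_on by (intro Least_le) blast
  also have "\<dots> \<le> card (states A)"
    by (rule width_le_card[OF assms])
  finally show ?thesis .
qed

text \<open>By antisymmetry a related pair of distinct states is strictly related, so its labels
  must be comparable. Hence X is an antichain in every co-lex order, in particular in one of minimum
  width.\<close>

lemma card_incomparable_le_colex_width:
  assumes "finite (states A)" "X \<subseteq> states A"
    and incomp: "\<And>u v. u \<in> X \<Longrightarrow> v \<in> X \<Longrightarrow> \<not> labels_le (in_labels A u) (in_labels A v)"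
  shows "card X \<le> colex_width A"
proof -
  have "\<exists>k r. colex_order A r \<and> width (states A) r = k"
    using colex_order_Id_on by blast
  then have "\<exists>r. colex_order A r \<and> width (states A) r = colex_width A"
    unfolding colex_width_def by (rule LeastI_ex)
  then obtain r where r: "colex_order A r" and w: "width (states A) r = colex_width A"
    by blast
  have "(u, v) \<notin> r" if "u \<in> X" "v \<in> X" "u \<noteq> v" for u v
    using r that incomp[of u v]
    unfolding colex_order_def partial_order_on_def antisym_def by blast
  then have "antichain_in (states A) r X"
    using assms(2) by (auto simp: antichain_in_def)
  then show ?thesis
    using card_antichain_le_width[OF assms(1)] w by metis
qed

section \<open>Quotients by the maximum co-lex relation and by the CFS order\<close>

lemma induced_equiv_max_colex_rel_subset:
  "induced_equiv (max_colex_rel A) \<subseteq>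
     {(u, v). u \<in> states A \<and> v \<in> states A \<and> (u \<noteq> v \<longrightarrow>
        labels_le (in_labels A u) (in_labels A v) \<and> labels_le (in_labels A v) (in_labels A u))}"
proof -
  have "u \<in> states A \<and> v \<in> states A \<and> (u \<noteq> v \<longrightarrow> labels_le (in_labels A u) (in_labels A v))"
    if max: "(u, v) \<in> max_colex_rel A" for u v
  proof -
    obtain r where r: "colex_rel A r" and uv: "(u, v) \<in> r"
      using max unfolding max_colex_rel_def by blast
    have "r \<subseteq> states A \<times> states A"
      and "\<forall>u v. u \<noteq> v \<and> (u, v) \<in> r \<longrightarrow> labels_le (in_labels A u) (in_labels A v)"
      using r unfolding colex_rel_def by simp_all
    with uv show ?thesis by blast
  qed
  then show ?thesis
    by (auto simp: induced_equiv_def)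
qed

text \<open>Together with the preceding upper bound this sandwiches the equivalence between two
  explicit relations, which coincide on the star automata.\<close>

lemma Id_on_subset_induced_equiv_max_colex_rel:
  "Id_on (states A) \<subseteq> induced_equiv (max_colex_rel A)"
proof -
  have "colex_rel A (Id_on (states A))"
    by (auto simp: colex_rel_def refl_on_def)
  then show ?thesis
    by (auto simp: induced_equiv_def max_colex_rel_def)
qed

text \<open>Two coarsest partitions refine each other, and refinement is antisymmetric.\<close>

lemma coarsest_fs_eqI:
  assumes "is_coarsest_fs A P"
  shows "coarsest_fs A = P"
  unfolding coarsest_fs_def
proof (rule the_equality[where P = "is_coarsest_fs A", OF assms])
  fix P' assume "is_coarsest_fs A P'"
  then show "P' = P"
    using assms refines_asym unfolding is_coarsest_fs_def by blast
qed

text \<open>A class of \<open>induced_equiv (cfs_order A)\<close> is determined by the part of its elements, whatever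
  \<open>max_colex_order\<close> is; so the existence of a maximum co-lex order is never needed.\<close>

lemma card_cfs_quotient_le:
  assumes "finite (coarsest_fs A)" "partition_on (states A) (coarsest_fs A)"
  shows "finite (states (cfs_quotient A))"
    and "card (states (cfs_quotient A)) \<le> card (coarsest_fs A)"
proof -
  let ?f = "\<lambda>S. {v \<in> states A.
     (S, fs_equiv A `` {v}) \<in> max_colex_order (quotient_nfa A (fs_equiv A)) \<and>
     (fs_equiv A `` {v}, S) \<in> max_colex_order (quotient_nfa A (fs_equiv A))}"
  \<comment> \<open>As parts are disjoint, the image of u under \<open>fs_equiv A\<close> is the one
    part containing u. Thus every state of the quotient is a value of \<open>?f\<close> at a
    part.\<close>
  have "fs_equiv A `` {u} \<in> coarsest_fs A" if u: "u \<in> states A" for u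
  proof -
    obtain S where S: "S \<in> coarsest_fs A" "u \<in> S"
      using u partition_onD1[OF assms(2)] by blast
    have "v \<in> S" if "(u, v) \<in> fs_equiv A" for v
      using that disjointD[OF partition_onD2[OF assms(2)] S(1)] S(2)
      unfolding fs_equiv_def by blast
    moreover have "(u, v) \<in> fs_equiv A" if "v \<in> S" for v
      using that S unfolding fs_equiv_def by blast
    ultimately have "fs_equiv A `` {u} = S"
      by blast
    then show ?thesis using S by simp
  qed
  moreover have "induced_equiv (cfs_order A) `` {u} = ?f (fs_equiv A `` {u})"
    if "u \<in> states A" for u
    using that by (auto simp: induced_equiv_def cfs_order_def)
  ultimately have sub: "states (cfs_quotient A) \<subseteq> ?f ` coarsest_fs A"
    unfolding cfs_quotient_def quotient_nfa_def quotient_def by auto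
  then show "finite (states (cfs_quotient A))"
    using assms(1) by (meson finite_imageI finite_subset)
  show "card (states (cfs_quotient A)) \<le> card (coarsest_fs A)"
    using surj_card_le[OF assms(1) sub] .
qed

section \<open>The star automata\<close>

text \<open>One character would not suffice: all pairs of leaves, together with the identity, would
  then form a co-lex relation and the leaves would be merged.\<close>

definition star_nfa :: "nat \<Rightarrow> (nat, nat) nfa" where
  "star_nfa n =
     \<lparr>states = {..n}, alphabet = {0, 1}, delta = (\<lambda>u a. if u = 0 then {1..n} else {}), start = 0\<rparr>"

lemma star_nfa_sel [simp]:
  "states (star_nfa n) = {..n}" "alphabet (star_nfa n) = {0, 1}" "start (star_nfa n) = 0"
  "delta (star_nfa n) u a = (if u = 0 then {1..n} else {})"
  by (simp_all add: star_nfa_def)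

lemma is_nfa_star_nfa:
  assumes "n \<ge> 1"
  shows "is_nfa (star_nfa n)"
proof -
  have "(0, u) \<in> (edges (star_nfa n))\<^sup>*" if "u \<le> n" for u
  proof (cases "u = 0")
    case False
    with that have "(0, u) \<in> edges (star_nfa n)"
      by (auto simp: edges_def)
    then show ?thesis ..
  qed simp
  with assms show ?thesis
    by (auto simp: is_nfa_def)
qed

lemma in_labels_star_nfa:
  assumes "u \<in> {..n}"
  shows "in_labels (star_nfa n) u = (if u = 0 then {None} else {Some 0, Some 1})"
  using assms by (auto simp: in_labels_def)

text \<open>Two distinct leaves fail because \<open>Some 1\<close> is not below
  \<open>Some 0\<close>; a leaf and the start state fail in one direction because
  \<open>None\<close> is strictly least.\<close>

lemma induced_equiv_star_nfa: "induced_equiv (max_colex_rel (star_nfa n)) = Id_on {..n}"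
proof
  show "induced_equiv (max_colex_rel (star_nfa n)) \<subseteq> Id_on {..n}"
    using induced_equiv_max_colex_rel_subset[of "star_nfa n"]
    by (fastforce simp: in_labels_star_nfa labels_le_def split: if_splits)
  show "Id_on {..n} \<subseteq> induced_equiv (max_colex_rel (star_nfa n))"
    using Id_on_subset_induced_equiv_max_colex_rel[of "star_nfa n"] by simp
qed

lemma states_colex_rel_quotient_star_nfa:
  "states (colex_rel_quotient (star_nfa n)) = (\<lambda>u. {u}) ` {..n}"
proof -
  have "Id_on {..n} `` {u} = {u}" if "u \<le> n" for u
    using that by auto
  then show ?thesis
    unfolding colex_rel_quotient_def quotient_nfa_def induced_equiv_star_nfa
    by (auto simp: quotient_def)
qed

lemma card_colex_rel_quotient_star_nfa:
  "card (states (colex_rel_quotient (star_nfa n))) = Suc n"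
  by (simp add: states_colex_rel_quotient_star_nfa card_image)

lemma in_labels_colex_rel_quotient_star_nfa:
  assumes "u \<in> {1..n}"
  shows "in_labels (colex_rel_quotient (star_nfa n)) {u} = {Some 0, Some 1}"
proof -
  let ?B = "colex_rel_quotient (star_nfa n)"
  have "start ?B = {0}" "alphabet ?B = {0, 1}"
    by (auto simp: colex_rel_quotient_def quotient_nfa_def induced_equiv_star_nfa)
  moreover have "{u} \<in> delta ?B {0} a" for a
  proof -
    have "{u} \<in> states ?B"
      using assms by (simp add: states_colex_rel_quotient_star_nfa)
    then show ?thesis
      using assms by (simp add: colex_rel_quotient_def quotient_nfa_def)
  qed
  moreover have "{0} \<in> states ?B"
    by (simp add: states_colex_rel_quotient_star_nfa)
  ultimately have "{a \<in> alphabet ?B. \<exists>U\<in>states ?B. {u} \<in> delta ?B U a} = {0, 1}"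
    "{u} \<noteq> start ?B"
    using assms by auto
  then show ?thesis
    unfolding in_labels_def by simp
qed

lemma colex_width_colex_rel_quotient_star_nfa:
  "n \<le> colex_width (colex_rel_quotient (star_nfa n))"
  "colex_width (colex_rel_quotient (star_nfa n)) \<le> Suc n"
proof -
  let ?B = "colex_rel_quotient (star_nfa n)"
  have fin: "finite (states ?B)"
    by (simp add: states_colex_rel_quotient_star_nfa)
  \<comment> \<open>The class \<open>{0}\<close> is left out: its label set \<open>{None}\<close>
    lies below every label set.\<close>
  have "card ((\<lambda>u. {u}) ` {1..n}) \<le> colex_width ?B"
  proof (rule card_incomparable_le_colex_width[OF fin])
    show "(\<lambda>u. {u}) ` {1..n} \<subseteq> states ?B"
      by (auto simp: states_colex_rel_quotient_star_nfa)
  next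
    fix U V assume "U \<in> (\<lambda>u. {u}) ` {1..n}" "V \<in> (\<lambda>u. {u}) ` {1..n}"
    then have "in_labels ?B U = {Some 0, Some 1}" "in_labels ?B V = {Some 0, Some 1}"
      using in_labels_colex_rel_quotient_star_nfa by blast+
    then show "\<not> labels_le (in_labels ?B U) (in_labels ?B V)"
      by (simp add: labels_le_def)
  qed
  then show "n \<le> colex_width ?B"
    by (simp add: card_image)
  show "colex_width ?B \<le> Suc n"
    using colex_width_le_card[OF fin] by (simp add: card_colex_rel_quotient_star_nfa)
qed

lemma partition_on_star_nfa:
  fixes n :: nat
  assumes "n \<ge> 1"
  shows "partition_on {..n} {{0}, {1..n}}"
proof -
  have "{..n} = insert 0 {1..n}" by auto
  with assms show ?thesis
    by (auto simp: partition_on_def disjoint_def)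
qed

lemma coarsest_fs_star_nfa:
  assumes "n \<ge> 1"
  shows "coarsest_fs (star_nfa n) = {{0}, {1..n}}"
proof (rule coarsest_fs_eqI)
  have "refines {..n} P {{0}, {1..n}}" if fs: "forward_stable (star_nfa n) P" for P
  proof -
    have part: "partition_on {..n} P"
      using fs by (simp add: forward_stable_def)
    have "S \<subseteq> {0} \<or> S \<subseteq> {1..n}" if S: "S \<in> P" for S
    proof -
      have le: "S \<subseteq> {..n}"
        using part S unfolding partition_on_def by blast
      \<comment> \<open>Take T = S. If S contains 0, its successor set under either character is
        \<open>{1..n}\<close>, which misses 0; stability then makes S disjoint from it, so S is
        \<open>{0}\<close>.\<close>
      have "forward_stable_wrt (star_nfa n) S S"
        using fs S by (simp add: forward_stable_def)
      then have "S \<subseteq> {1..n} \<or> S \<inter> {1..n} = {}" if "0 \<in> S"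
        using that unfolding forward_stable_wrt_def delta_set_def by (auto split: if_splits)
      moreover have "x = 0 \<or> x \<in> {1..n}" if "x \<in> S" for x
        using le that by force
      ultimately show ?thesis by fastforce
    qed
    then show ?thesis
      using part partition_on_star_nfa[OF assms] by (auto simp: refines_def)
  qed
  then show "is_coarsest_fs (star_nfa n) {{0}, {1..n}}"
    using partition_on_star_nfa[OF assms]
    by (auto simp: is_coarsest_fs_def forward_stable_def forward_stable_wrt_def delta_set_def)
qed

lemma cfs_quotient_star_nfa:
  assumes "n \<ge> 1"
  shows "card (states (cfs_quotient (star_nfa n))) \<le> 2"
    and "colex_width (cfs_quotient (star_nfa n)) \<le> 2"
proof -
  let ?A = "star_nfa n"
  have "finite (coarsest_fs ?A)" "partition_on (states ?A) (coarsest_fs ?A)"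
    using coarsest_fs_star_nfa[OF assms] partition_on_star_nfa[OF assms] by simp_all
  note le = card_cfs_quotient_le[OF this]
  have "card (coarsest_fs ?A) \<le> 2"
    unfolding coarsest_fs_star_nfa[OF assms] by (simp add: card_insert_if)
  with le(2) show "card (states (cfs_quotient ?A)) \<le> 2"
    by linarith
  with colex_width_le_card[OF le(1)] show "colex_width (cfs_quotient ?A) \<le> 2"
    by linarith
qed

text \<open>Upper bounds linear in the number of states hold for every quotient, so the first pair
  of bounds is stated with \<Theta>. Over \<open>principal C\<close> each bound holds with one
  constant for all of C.\<close>

theorem theorem2:
  shows "\<exists>C :: (nat, nat) nfa set.
    (\<forall>A\<in>C. is_nfa A) \<and>
    (\<forall>n. \<exists>A\<in>C. n \<le> card (states A)) \<and>
    (\<lambda>A. real (card (states (colex_rel_quotient A)))) \<in> \<Theta>[principal C](\<lambda>A. real (card (states A))) \<and>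
    (\<lambda>A. real (colex_width (colex_rel_quotient A))) \<in> \<Theta>[principal C](\<lambda>A. real (card (states A))) \<and>
    (\<lambda>A. real (card (states (cfs_quotient A)))) \<in> O[principal C](\<lambda>_. 1) \<and>
    (\<lambda>A. real (colex_width (cfs_quotient A))) \<in> O[principal C](\<lambda>_. 1)"
\<comment> \<open>The index 0 is excluded: without leaves the two characters would label no
  edge.\<close>
proof (intro exI[of _ "star_nfa ` {1..}"] conjI)
  let ?C = "star_nfa ` {1..}"
  show "\<forall>A\<in>?C. is_nfa A"
    using is_nfa_star_nfa by auto
  show "\<forall>n. \<exists>A\<in>?C. n \<le> card (states A)"
  proof
    fix n
    show "\<exists>A\<in>?C. n \<le> card (states A)"
      by (rule bexI[of _ "star_nfa (Suc n)"]) auto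
  qed
  show "(\<lambda>A. real (card (states (colex_rel_quotient A)))) \<in> \<Theta>[principal ?C](\<lambda>A. real (card (states A)))"
    by (rule bigthetaI_cong) (auto simp: eventually_principal card_colex_rel_quotient_star_nfa)
  show "(\<lambda>A. real (colex_width (colex_rel_quotient A))) \<in> \<Theta>[principal ?C](\<lambda>A. real (card (states A)))"
  proof (rule bigthetaI)
    show "(\<lambda>A. real (colex_width (colex_rel_quotient A))) \<in> O[principal ?C](\<lambda>A. real (card (states A)))"
      using colex_width_colex_rel_quotient_star_nfa(2)
      by (intro bigoI[of _ 1]) (fastforce simp: eventually_principal)
    \<comment> \<open>The factor 2 absorbs the start state, which is missing from the antichain of n
      leaves: n + 1 \<le> 2n for n \<ge> 1.\<close>
    have "real (Suc n) \<le> 2 * real (colex_width (colex_rel_quotient (star_nfa n)))" if "n \<ge> 1" for n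
      using colex_width_colex_rel_quotient_star_nfa(1)[of n] that by linarith
    then have "(\<lambda>A. real (card (states A))) \<in> O[principal ?C](\<lambda>A. real (colex_width (colex_rel_quotient A)))"
      by (intro bigoI[of _ 2]) (fastforce simp: eventually_principal)
    then show "(\<lambda>A. real (colex_width (colex_rel_quotient A))) \<in> \<Omega>[principal ?C](\<lambda>A. real (card (states A)))"
      by (simp add: bigomega_iff_bigo)
  qed
  show "(\<lambda>A. real (card (states (cfs_quotient A)))) \<in> O[principal ?C](\<lambda>_. 1)"
    using cfs_quotient_star_nfa(1)
    by (intro bigoI[of _ 2]) (fastforce simp: eventually_principal)
  show "(\<lambda>A. real (colex_width (cfs_quotient A))) \<in> O[principal ?C](\<lambda>_. 1)"
    using cfs_quotient_star_nfa(2)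
    by (intro bigoI[of _ 2]) (fastforce simp: eventually_principal)
qed

end
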